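(* For $n=0,1,\ldots$ let $G_n(x)=\frac1\pi\int_{-\infty}^\infty\frac{e^{-t^2/2}H_n(t)}{t-x}\,dt$. Then for every $m=0,1,\ldots$ and $0<x<\infty$, $$\left(\frac{d^2}{dx^2}+4m+1-x^2\right)G_{2m}(x)=\sqrt{\frac2\pi}\,\frac{(2m)!}{m!}\,x,\qquad G_{2m}(0)=0,$$ $$\left(\frac{d^2}{dx^2}+4m+3-x^2\right)G_{2m+1}(x)=\sqrt{\frac2\pi}\,\frac{2(2m+1)!}{m!},\qquad \frac{dG_{2m+1}}{dx}(0)=0.$$
   Context: The integral is a Cauchy principal value, and $G_n$ is defined for all real $x$. $H_n$ are the Hermite polynomials orthogonal on $(-\infty,\infty)$ with weight $e^{-x^2}$ and with leading coefficient $2^n$. *)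

theory Defs
  imports
    "HOL-Analysis.Analysis"
    "HOL-Computational_Algebra.Polynomial"
begin

definition is_hermite_system :: "(nat \<Rightarrow> real poly) \<Rightarrow> bool" where
  "is_hermite_system H \<longleftrightarrow>
     (\<forall>n. degree (H n) = n \<and> lead_coeff (H n) = 2 ^ n) \<and>
     (\<forall>m n. m \<noteq> n \<longrightarrow>
        has_bochner_integral lborel
          (\<lambda>t. exp (- (t ^ 2)) * poly (H m) t * poly (H n) t) 0)"

definition hermite :: "nat \<Rightarrow> real poly" where
  "hermite = (THE H. is_hermite_system H)"

text \<open>
  Cauchy principal value over the whole line of a function with a single singularity,
  at \<open>x\<close>.  Away from \<open>x\<close> the integral is required to converge absolutely, so no symmetric
  truncation at infinity is involved.
\<close>

definition has_principal_value :: "(real \<Rightarrow> real) \<Rightarrow> real \<Rightarrow> real \<Rightarrow> bool" where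
  "has_principal_value f x L \<longleftrightarrow>
     (\<forall>\<epsilon>>0. set_integrable lborel {t. \<bar>t - x\<bar> > \<epsilon>} f) \<and>
     ((\<lambda>\<epsilon>. LINT t:{t. \<bar>t - x\<bar> > \<epsilon>}|lborel. f t) \<longlongrightarrow> L) (at_right 0)"

definition principal_value :: "(real \<Rightarrow> real) \<Rightarrow> real \<Rightarrow> real" where
  "principal_value f x = (THE L. has_principal_value f x L)"

definition G_integrand :: "nat \<Rightarrow> real \<Rightarrow> real \<Rightarrow> real" where
  "G_integrand n x t = exp (- (t ^ 2) / 2) * poly (hermite n) t / (t - x)"

definition G :: "nat \<Rightarrow> real \<Rightarrow> real" where
  "G n x = 1 / pi * principal_value (G_integrand n x) x"

end

(*
  For a polynomial p put T p (x) = PV int exp(-t^2/2) p(t) / (t - x) dt and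
  M p = int exp(-t^2/2) p(t) dt.  Writing t = x + (t - x) gives T(X p) = x T p + M p, so that
  every T p reduces to T 1.  Symmetrising t = x + s and t = x - s turns T 1 into
  - exp(-x^2/2) int exp(-s^2/2) sinh(x s) / s ds, an absolutely convergent integral whose derivative
  is a Gaussian integral; hence (T 1)' = - x T 1 - sqrt(2 pi).  By induction on p it follows that
  (T p)' = T(p' - X p).  The Hermite equation H_n'' - 2 X H_n' = -2 n H_n then gives
  (T H_n)'' = T((X^2 - 2n - 1) H_n) = (x^2 - 2n - 1) T H_n + x M(H_n) + M(X H_n),
  and the moments follow from M(X p) = M(p').  The values at 0 follow from H_(n+1) = 2 X H_n - H_n'
  and the derivative rule for T.
*)
theory Submission
  imports Defs "HOL-Probability.Distributions"
begin

section \<open>Gaussian integrals of polynomials\<close>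

text \<open>Two values of \<open>a\<close> matter: 1, the weight of orthogonality, and 1/2, the
  weight in the integrand of \<open>G\<close>.\<close>

definition gauss_int :: "real \<Rightarrow> real poly \<Rightarrow> real" where
  "gauss_int a p = (\<integral>t. exp (- (a * t\<^sup>2)) * poly p t \<partial>lborel)"

lemma exp_eq_normal_density:
  assumes "a > 0"
  shows "exp (- (a * t\<^sup>2)) = sqrt (pi / a) * normal_density 0 (1 / sqrt (2 * a)) t"
  using assms
  by (simp add: normal_density_def power_divide real_sqrt_divide real_sqrt_mult field_simps)

lemma gauss_power_integrable:
  assumes "a > 0"
  shows "integrable lborel (\<lambda>t. exp (- (a * t\<^sup>2)) * t ^ k :: real)"
proof -
  have "integrable lborel (\<lambda>t. sqrt (pi / a) * (normal_density 0 (1 / sqrt (2 * a)) t * (t - 0) ^ k))"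
    by (intro integrable_mult_right integrable_normal_moment) (use assms in simp)
  then show ?thesis
    by (simp only: exp_eq_normal_density[OF assms] mult.assoc diff_zero)
qed

lemma gauss_int_even_power:
  assumes "a > 0"
  shows "gauss_int a (monom 1 (2 * k)) = sqrt (pi / a) * (fact (2 * k) / ((4 * a) ^ k * fact k))"
proof -
  have "gauss_int a (monom 1 (2 * k)) =
    (\<integral>t. sqrt (pi / a) * (normal_density 0 (1 / sqrt (2 * a)) t * (t - 0) ^ (2 * k)) \<partial>lborel)"
    by (simp only: gauss_int_def poly_monom exp_eq_normal_density[OF assms] mult.assoc mult_1 diff_zero)
  also have "\<dots> = sqrt (pi / a) * (fact (2 * k) / ((2 / (1 / sqrt (2 * a))\<^sup>2) ^ k * fact k))"
    by (subst integral_mult_right_zero, subst integral_normal_moment_even) (use assms in simp_all)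
  finally show ?thesis
    using assms by (simp add: power_divide)
qed

lemma gauss_int_odd_power:
  assumes "a > 0"
  shows "gauss_int a (monom 1 (2 * k + 1)) = 0"
proof -
  have "gauss_int a (monom 1 (2 * k + 1)) =
    (\<integral>t. sqrt (pi / a) * (normal_density 0 (1 / sqrt (2 * a)) t * (t - 0) ^ (2 * k + 1)) \<partial>lborel)"
    by (simp only: gauss_int_def poly_monom exp_eq_normal_density[OF assms] mult.assoc mult_1 diff_zero)
  also have "\<dots> = 0"
    by (subst integral_mult_right_zero, subst integral_normal_moment_odd) (use assms in simp_all)
  finally show ?thesis .
qed

lemma gauss_poly_integrable:
  assumes "a > 0"
  shows "integrable lborel (\<lambda>t. exp (- (a * t\<^sup>2)) * poly p t :: real)"
proof -
  have "integrable lborel (\<lambda>t. \<Sum>i\<le>degree p. coeff p i * (exp (- (a * t\<^sup>2)) * t ^ i))"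
    using gauss_power_integrable[OF assms] by simp
  then show ?thesis
    by (simp add: poly_altdef sum_distrib_left mult_ac)
qed

lemma gauss_int_add: "a > 0 \<Longrightarrow> gauss_int a (p + q) = gauss_int a p + gauss_int a q"
  unfolding gauss_int_def
  by (subst Bochner_Integration.integral_add [symmetric])
    (simp_all add: distrib_left gauss_poly_integrable)

lemma gauss_int_diff: "a > 0 \<Longrightarrow> gauss_int a (p - q) = gauss_int a p - gauss_int a q"
  unfolding gauss_int_def
  by (subst Bochner_Integration.integral_diff [symmetric])
    (simp_all add: right_diff_distrib gauss_poly_integrable)

lemma gauss_int_smult: "gauss_int a (smult c p) = c * gauss_int a p"
proof -
  have "gauss_int a (smult c p) = (\<integral>t. c * (exp (- (a * t\<^sup>2)) * poly p t) \<partial>lborel)"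
    by (simp add: gauss_int_def mult_ac)
  then show ?thesis
    by (simp add: gauss_int_def)
qed

lemma gauss_int_0 [simp]: "gauss_int a 0 = 0"
  by (simp add: gauss_int_def)

text \<open>Integration by parts, read off from the explicit moments: for even \<open>k\<close> both
  sides are odd moments and vanish; for odd \<open>k\<close> consecutive even moments have the right
  ratio.\<close>

lemma gauss_int_pderiv_monom:
  assumes "a > 0"
  shows "gauss_int a (pderiv (monom 1 k)) = 2 * a * gauss_int a (pCons 0 (monom 1 k))"
proof (cases "even k")
  case True
  show ?thesis
  proof (cases k)
    case 0
    have "gauss_int a (monom 1 1) = 0"
      using gauss_int_odd_power[OF assms, of 0] by simp
    then show ?thesis
      using 0 by (simp add: pderiv_monom monom_Suc)
  next
    case (Suc j)
    with True obtain i where i: "j = 2 * i + 1"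
      by (auto elim: oddE)
    have "gauss_int a (monom (real (Suc j)) j) = real (Suc j) * gauss_int a (monom 1 j)"
      by (subst gauss_int_smult [symmetric]) (simp add: smult_monom)
    then show ?thesis
      using gauss_int_odd_power[OF assms, of i] gauss_int_odd_power[OF assms, of "i + 1"] Suc i
      by (simp add: pderiv_monom flip: monom_Suc)
  qed
next
  case False
  then obtain i where i: "k = 2 * i + 1"
    by (auto elim: oddE)
  have "(1 + 2 * real i) * (fact (2 * i) / ((4 * a) ^ i * fact i)) =
      2 * a * (fact (2 * (i + 1)) / ((4 * a) ^ (i + 1) * fact (i + 1)))"
    using assms by (simp add: divide_simps)
  then have "real k * gauss_int a (monom 1 (2 * i)) = 2 * a * gauss_int a (monom 1 (2 * (i + 1)))"
    unfolding gauss_int_even_power[OF assms] mult.left_commute[of _ "sqrt (pi / a)"]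
    by (simp only: i) (simp add: algebra_simps)
  moreover have "gauss_int a (monom (real k) (2 * i)) = real k * gauss_int a (monom 1 (2 * i))"
    by (subst gauss_int_smult [symmetric]) (simp add: smult_monom)
  moreover have "pCons 0 (monom 1 k) = monom (1 :: real) (2 * (i + 1))"
    by (simp add: i monom_Suc)
  ultimately show ?thesis
    by (simp only: pderiv_monom) (simp add: i)
qed

lemma gauss_int_pderiv:
  assumes "a > 0"
  shows "gauss_int a (pderiv p) = 2 * a * gauss_int a (pCons 0 p)"
proof -
  \<comment> \<open>Peeling off the constant coefficient of \<open>p\<close> raises the power of the
    monomial in front, so the induction must allow every \<open>k\<close>.\<close>
  have "gauss_int a (pderiv (monom 1 k * p)) = 2 * a * gauss_int a (pCons 0 (monom 1 k * p))" for k
  proof (induction p arbitrary: k)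
    case (pCons c q)
    have "monom 1 k * pCons c q = smult c (monom 1 k) + monom 1 (Suc k) * q"
      by (simp add: monom_Suc mult_pCons_right)
    moreover have "pCons 0 (r + s) = pCons 0 r + pCons 0 s" for r s :: "real poly"
      by simp
    moreover have "pCons 0 (smult c r) = smult c (pCons 0 r)" for r
      by simp
    ultimately show ?case
      by (simp only: pderiv_add pderiv_smult gauss_int_add[OF assms] gauss_int_smult
          pCons.IH gauss_int_pderiv_monom[OF assms] distrib_left mult.left_commute)
  qed simp
  from this[of 0] show ?thesis
    by simp
qed

lemma gauss_int_square_eq_0:
  assumes "a > 0" "gauss_int a (p * p) = 0"
  shows "p = 0"
proof -
  have "AE t in lborel. exp (- (a * t\<^sup>2)) * poly (p * p) t = 0"
    using integral_nonneg_eq_0_iff_AE[OF gauss_poly_integrable[OF assms(1), of "p * p"]] assms(2)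
    by (simp add: gauss_int_def)
  then have "AE t in lborel. t \<in> {t. poly p t = 0}"
    by simp
  show ?thesis
  proof (rule ccontr)
    assume "p \<noteq> 0"
    then have "finite {t. poly p t = 0}"
      by (rule poly_roots_finite)
    then have "AE t in lborel. t \<notin> {t. poly p t = 0}"
      by (intro AE_not_in finite_imp_null_set_lborel)
    \<comment> \<open>The root set would be both null and of full measure.\<close>
    with \<open>AE t in lborel. t \<in> _\<close> have "AE t in (lborel :: real measure). False"
      by eventually_elim simp
    then show False
      by (simp add: AE_iff_null null_sets_def)
  qed
qed

section \<open>Hermite polynomials\<close>

text \<open>Differentiating the Rodrigues formula H_n = (-1)^n exp(x^2) D^n exp(-x^2) gives this
  recurrence.\<close>

fun physicist_hermite :: "nat \<Rightarrow> real poly" where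
  "physicist_hermite 0 = 1"
| "physicist_hermite (Suc n) = smult 2 (pCons 0 (physicist_hermite n)) - pderiv (physicist_hermite n)"

lemma degree_lead_coeff_physicist_hermite:
  "degree (physicist_hermite n) = n \<and> coeff (physicist_hermite n) n = 2 ^ n"
proof (induction n)
  case (Suc n)
  let ?q = "smult 2 (pCons 0 (physicist_hermite n))"
  have nz: "physicist_hermite n \<noteq> 0"
    using Suc.IH by force
  have deg: "degree ?q = Suc n"
    using Suc.IH nz by simp
  have "degree (pderiv (physicist_hermite n)) < Suc n"
    using Suc.IH by (simp add: degree_pderiv)
  then have "degree (?q - pderiv (physicist_hermite n)) = Suc n"
    and "coeff (pderiv (physicist_hermite n)) (Suc n) = 0"
    using deg degree_add_eq_left[of "- pderiv (physicist_hermite n)" ?q] by (simp_all add: coeff_eq_0)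
  then show ?case
    using Suc.IH by simp
qed simp

text \<open>Differentiating the recurrence leaves 2 H_(n+1) + 2 X H_(n+1)' - H_(n+1)''. By the
  induction hypothesis the last two terms are 2(n+1) (2 X H_n - H_n'), which is 2(n+1)
  H_(n+1).\<close>

lemma pderiv_physicist_hermite_Suc:
  "pderiv (physicist_hermite (Suc n)) = smult (2 * real (Suc n)) (physicist_hermite n)"
proof (induction n)
  case 0
  then show ?case
    by (simp add: pderiv_pCons pderiv_diff pderiv_smult one_pCons)
next
  case (Suc n)
  show ?case
  proof (subst physicist_hermite.simps(2), rule poly_eqI)
    fix k
    show "coeff (pderiv (smult 2 (pCons 0 (physicist_hermite (Suc n))) - pderiv (physicist_hermite (Suc n)))) k
        = coeff (smult (2 * real (Suc (Suc n))) (physicist_hermite (Suc n))) k"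
      unfolding Suc.IH pderiv_diff pderiv_smult pderiv_pCons
      by (simp add: smult_diff_right coeff_pCons Suc.IH algebra_simps split: nat.split)
  qed
qed


text \<open>Repeated integration by parts moves all derivatives of the Rodrigues formula to the factor \<open>q\<close>.\<close>

lemma gauss_int_physicist_hermite_mult:
  "gauss_int 1 (physicist_hermite n * q) = gauss_int 1 ((pderiv ^^ n) q)"
proof (induction n arbitrary: q)
  case (Suc n)
  let ?p = "physicist_hermite n"
  have "physicist_hermite (Suc n) * q = smult 2 (pCons 0 (?p * q)) - pderiv ?p * q"
    by (simp add: left_diff_distrib)
  moreover have "gauss_int 1 (pderiv ?p * q) = 2 * gauss_int 1 (pCons 0 (?p * q)) - gauss_int 1 (?p * pderiv q)"
    using gauss_int_pderiv[of 1 "?p * q"] by (simp add: pderiv_mult gauss_int_add mult.commute)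
  ultimately have "gauss_int 1 (physicist_hermite (Suc n) * q) = gauss_int 1 (?p * pderiv q)"
    by (simp only: gauss_int_diff gauss_int_smult)
  then show ?case
    by (simp add: Suc.IH funpow_swap1)
qed simp

lemma gauss_int_physicist_hermite_mult_eq_0:
  assumes "degree q < n"
  shows "gauss_int 1 (physicist_hermite n * q) = 0"
proof -
  have "(pderiv ^^ n) q = 0"
    using assms
  proof (induction n arbitrary: q)
    case (Suc n)
    show ?case
    proof (cases "degree q = 0")
      case True
      then show ?thesis
        by (metis funpow_swap1 funpow.simps(2) comp_apply higher_pderiv_0 pderiv_eq_0_iff)
    next
      case False
      then show ?thesis
        using Suc by (simp add: funpow_swap1 degree_pderiv)
    qed
  qed simp
  then show ?thesis
    by (simp add: gauss_int_physicist_hermite_mult)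
qed

text \<open>A polynomial times the Gaussian is always integrable, so orthogonality is only a
  condition on the value of the integral.\<close>

lemma is_hermite_system_iff_gauss_int:
  "is_hermite_system H \<longleftrightarrow> (\<forall>n. degree (H n) = n \<and> lead_coeff (H n) = 2 ^ n) \<and>
     (\<forall>m n. m \<noteq> n \<longrightarrow> gauss_int 1 (H m * H n) = 0)"
proof -
  have "has_bochner_integral lborel (\<lambda>t. exp (- (t\<^sup>2)) * poly p t * poly q t) 0 \<longleftrightarrow>
      gauss_int 1 (p * q) = 0" for p q
    using gauss_poly_integrable[of 1 "p * q"]
    by (simp add: gauss_int_def has_bochner_integral_iff mult.assoc)
  then show ?thesis
    by (simp add: is_hermite_system_def)
qed

lemma is_hermite_system_physicist_hermite: "is_hermite_system physicist_hermite"
proof -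
  have "gauss_int 1 (physicist_hermite m * physicist_hermite n) = 0" if "m \<noteq> n" for m n
    using that
  proof (cases m n rule: linorder_cases)
    case less
    then show ?thesis
      by (subst mult.commute) (simp add: gauss_int_physicist_hermite_mult_eq_0 degree_lead_coeff_physicist_hermite)
  next
    case greater
    then show ?thesis
      by (simp add: gauss_int_physicist_hermite_mult_eq_0 degree_lead_coeff_physicist_hermite)
  qed simp
  then show ?thesis
    by (simp add: is_hermite_system_iff_gauss_int degree_lead_coeff_physicist_hermite)
qed

text \<open>Subtracting the multiple of \<open>H d\<close> with the same leading term lowers the
  degree of \<open>q\<close> without changing its pairing with \<open>H n\<close>. The case
  \<open>q = 0\<close> is listed separately because the zero polynomial has degree 0.\<close>

lemma hermite_system_orthogonal_lower_degree:
  assumes H: "is_hermite_system H" and "q = 0 \<or> degree q < n"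
  shows "gauss_int 1 (H n * q) = 0"
  using assms(2)
proof (induction "degree q" arbitrary: q rule: less_induct)
  case less
  show ?case
  proof (cases "q = 0")
    case False
    define d where "d = degree q"
    define c where "c = lead_coeff q / 2 ^ d"
    have d: "d < n" and degH: "degree (H d) = d" and lcH: "coeff (H d) d = 2 ^ d"
      using False less.prems H unfolding d_def is_hermite_system_def by metis+
    define r where "r = q - smult c (H d)"
    have "coeff r d = 0"
      using lcH by (simp add: r_def c_def flip: d_def)
    moreover have "degree r \<le> d"
      unfolding r_def by (intro degree_diff_le) (simp_all add: d_def[symmetric] degH)
    ultimately have "r = 0 \<or> degree r < d"
      by (metis eq_zero_or_degree_less)
    then have "gauss_int 1 (H n * r) = 0"
      using less.hyps[of r] d by (auto simp: d_def[symmetric])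
    moreover have "gauss_int 1 (H n * H d) = 0"
      using H d by (simp add: is_hermite_system_iff_gauss_int)
    moreover have "H n * q = H n * r + smult c (H n * H d)"
      by (simp add: r_def algebra_simps)
    ultimately show ?thesis
      by (simp add: gauss_int_add gauss_int_smult)
  qed simp
qed

lemma hermite_eq_physicist_hermite: "hermite = physicist_hermite"
  unfolding hermite_def
proof (rule the_equality)
  show "is_hermite_system physicist_hermite"
    by (rule is_hermite_system_physicist_hermite)
next
  fix H assume H: "is_hermite_system H"
  show "H = physicist_hermite"
  proof
    fix n
    \<comment> \<open>The leading terms cancel, so \<open>r\<close> is orthogonal to both
      polynomials and therefore to itself.\<close>
    define r where "r = H n - physicist_hermite n"
    have "degree (H n) = n" "coeff (H n) n = 2 ^ n"
      using H by (metis is_hermite_system_def)+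
    then have "degree r \<le> n" "coeff r n = 0"
      unfolding r_def by (auto intro!: degree_diff_le simp: degree_lead_coeff_physicist_hermite)
    then have "r = 0 \<or> degree r < n"
      by (metis eq_zero_or_degree_less)
    then have "gauss_int 1 (H n * r) = 0" "gauss_int 1 (physicist_hermite n * r) = 0"
      using hermite_system_orthogonal_lower_degree H is_hermite_system_physicist_hermite by blast+
    then have "gauss_int 1 (r * r) = 0"
      by (simp add: left_diff_distrib gauss_int_diff r_def)
    then have "r = 0"
      by (rule gauss_int_square_eq_0[rotated]) simp
    then show "H n = physicist_hermite n"
      by (simp add: r_def)
  qed
qed

section \<open>The Gaussian sinh kernel\<close>

text \<open>Reduces to sequences tending to \<open>x\<close>; as the bound holds only eventually,
  the first \<open>N\<close> terms are shifted away. It serves both for differentiating under the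
  integral and for letting the truncation radius tend to 0.\<close>

lemma integral_dominated_convergence_at:
  fixes s :: "real \<Rightarrow> 'a \<Rightarrow> real" and w f :: "'a \<Rightarrow> real"
  assumes meas: "\<And>y. s y \<in> borel_measurable M" "f \<in> borel_measurable M"
    and w: "integrable M w"
    and lim: "\<And>t. t \<in> space M \<Longrightarrow> ((\<lambda>y. s y t) \<longlongrightarrow> f t) (at x within A)"
    and bound: "\<forall>\<^sub>F y in at x within A. \<forall>t\<in>space M. \<bar>s y t\<bar> \<le> w t"
  shows "((\<lambda>y. \<integral>t. s y t \<partial>M) \<longlongrightarrow> (\<integral>t. f t \<partial>M)) (at x within A)"
  unfolding tendsto_at_iff_sequentially comp_def
proof (intro allI impI)
  fix X assume X: "\<forall>i. X i \<in> A - {x}" "X \<longlonglongrightarrow> x"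
  then have fX: "filterlim X (at x within A) sequentially"
    by (auto simp: filterlim_at)
  then obtain N where N: "\<And>n. n \<ge> N \<Longrightarrow> \<forall>t\<in>space M. \<bar>s (X n) t\<bar> \<le> w t"
    using eventually_compose_filterlim[OF bound fX] unfolding eventually_sequentially by blast
  have "(\<lambda>n. \<integral>t. s (X (n + N)) t \<partial>M) \<longlonglongrightarrow> (\<integral>t. f t \<partial>M)"
  proof (rule integral_dominated_convergence[OF meas(2) meas(1) w])
    show "AE t in M. (\<lambda>n. s (X (n + N)) t) \<longlonglongrightarrow> f t"
      using filterlim_compose[OF lim fX] by (intro AE_I2 LIMSEQ_ignore_initial_segment)
    show "AE t in M. norm (s (X (n + N)) t) \<le> w t" for n
      using N[of "n + N"] by (intro AE_I2) simp
  qed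
  then show "(\<lambda>n. \<integral>t. s (X n) t \<partial>M) \<longlonglongrightarrow> (\<integral>t. f t \<partial>M)"
    by (rule LIMSEQ_offset)
qed

text \<open>Completing the square turns exp(-s^2/2 + v s) into a multiple of the normal density with
  mean \<open>v\<close>; the cosh is the average of the cases v = u and v = -u.\<close>

lemma gauss_cosh_integral:
  "has_bochner_integral lborel (\<lambda>s::real. exp (- (s\<^sup>2) / 2) * cosh (u * s)) (sqrt (2 * pi) * exp (u\<^sup>2 / 2))"
proof -
  have *: "has_bochner_integral lborel (\<lambda>s::real. exp (- (s\<^sup>2) / 2 + v * s)) (sqrt (2 * pi) * exp (v\<^sup>2 / 2))" for v
  proof -
    have "exp (- (s\<^sup>2) / 2 + v * s) = sqrt (2 * pi) * exp (v\<^sup>2 / 2) * normal_density v 1 s" for s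
      by (simp add: normal_density_def power2_diff field_simps flip: exp_add)
    moreover have "has_bochner_integral lborel (normal_density v 1) 1"
      by (simp add: has_bochner_integral_iff)
    ultimately show ?thesis
      using has_bochner_integral_mult_right[where c = "sqrt (2 * pi) * exp (v\<^sup>2 / 2)"] by fastforce
  qed
  have "has_bochner_integral lborel
      (\<lambda>s. (exp (- (s\<^sup>2) / 2 + u * s) + exp (- (s\<^sup>2) / 2 + (- u) * s)) / 2)
      ((sqrt (2 * pi) * exp (u\<^sup>2 / 2) + sqrt (2 * pi) * exp ((- u)\<^sup>2 / 2)) / 2)"
    by (intro has_bochner_integral_divide_zero has_bochner_integral_add *)
  moreover have "(exp (- (s\<^sup>2) / 2 + u * s) + exp (- (s\<^sup>2) / 2 + (- u) * s)) / 2
      = exp (- (s\<^sup>2) / 2) * cosh (u * s)" for s :: real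
    unfolding exp_add by (simp add: cosh_def field_simps)
  ultimately show ?thesis
    by simp
qed

lemma abs_sinh_diff_le:
  fixes u v r :: real
  assumes "\<bar>u\<bar> \<le> r" "\<bar>v\<bar> \<le> r"
  shows "\<bar>sinh u - sinh v\<bar> \<le> cosh r * \<bar>u - v\<bar>"
proof -
  have "norm (sinh u - sinh v) \<le> cosh r * norm (u - v)"
  proof (rule field_differentiable_bound[where S = "{-r..r}"])
    show "(sinh has_field_derivative cosh z) (at z within {-r..r})" for z :: real
      by (auto intro!: derivative_eq_intros)
    show "norm (cosh z) \<le> cosh r" if "z \<in> {-r..r}" for z
      using that cosh_real_abs[of z] cosh_real_nonneg_le_iff[of "\<bar>z\<bar>" r] by (auto simp: abs_le_iff)
  qed (use assms in auto)
  then show ?thesis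
    by simp
qed

text \<open>At \<open>s = 0\<close> the integrand has the junk value 0 instead of \<open>x\<close>.\<close>

definition sinh_kernel_int :: "real \<Rightarrow> real" where
  "sinh_kernel_int x = (\<integral>s. exp (- (s\<^sup>2) / 2) * sinh (x * s) / s \<partial>lborel)"

text \<open>The mean value bound for sinh produces a factor \<open>\<bar>s\<bar>\<close> that
  cancels the denominator. The estimate gives integrability of the kernel, by comparison with the
  parameter 0, and a dominating function for its difference quotients.\<close>

lemma abs_sinh_kernel_diff_le:
  fixes x y r s :: real
  assumes "\<bar>x\<bar> \<le> r" "\<bar>y\<bar> \<le> r"
  shows "\<bar>exp (- (s\<^sup>2) / 2) * sinh (y * s) / s - exp (- (s\<^sup>2) / 2) * sinh (x * s) / s\<bar>
    \<le> \<bar>y - x\<bar> * (exp (- (s\<^sup>2) / 2) * cosh (r * s))"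
proof (cases "s = 0")
  case False
  have "\<bar>sinh (y * s) - sinh (x * s)\<bar> \<le> cosh (r * \<bar>s\<bar>) * \<bar>y * s - x * s\<bar>"
    by (intro abs_sinh_diff_le) (simp_all add: abs_mult assms mult_right_mono)
  also have "cosh (r * \<bar>s\<bar>) = cosh (r * s)"
    by (cases "s \<ge> 0") simp_all
  also have "\<bar>y * s - x * s\<bar> = \<bar>y - x\<bar> * \<bar>s\<bar>"
    by (simp flip: left_diff_distrib abs_mult)
  finally have "exp (- (s\<^sup>2) / 2) * (\<bar>sinh (y * s) - sinh (x * s)\<bar> / \<bar>s\<bar>) \<le> exp (- (s\<^sup>2) / 2) * (cosh (r * s) * \<bar>y - x\<bar>)"
    using False by (intro mult_left_mono) (simp_all add: divide_simps mult_ac)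
  moreover have "\<bar>exp (- (s\<^sup>2) / 2) * sinh (y * s) / s - exp (- (s\<^sup>2) / 2) * sinh (x * s) / s\<bar> =
      exp (- (s\<^sup>2) / 2) * (\<bar>sinh (y * s) - sinh (x * s)\<bar> / \<bar>s\<bar>)"
    by (simp add: abs_mult abs_divide flip: diff_divide_distrib right_diff_distrib)
  ultimately show ?thesis
    by (simp add: mult_ac)
qed simp

lemma abs_sinh_kernel_le:
  fixes x s :: real
  shows "\<bar>exp (- (s\<^sup>2) / 2) * sinh (x * s) / s\<bar> \<le> \<bar>x\<bar> * (exp (- (s\<^sup>2) / 2) * cosh (x * s))"
  using abs_sinh_kernel_diff_le[of 0 "\<bar>x\<bar>" x s] by (cases "x \<ge> 0") auto

lemma cosh_kernel_integrable:
  "integrable lborel (\<lambda>s::real. exp (- (s\<^sup>2) / 2) * cosh (u * s))"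
  using gauss_cosh_integral by (rule integrable.intros)

lemma borel_measurable_sinh_cosh [measurable]:
  "(sinh :: real \<Rightarrow> real) \<in> borel_measurable borel" "(cosh :: real \<Rightarrow> real) \<in> borel_measurable borel"
  by (intro borel_measurable_continuous_onI continuous_intros)+

lemma sinh_kernel_integrable:
  "integrable lborel (\<lambda>s::real. exp (- (s\<^sup>2) / 2) * sinh (x * s) / s)"
proof (rule Bochner_Integration.integrable_bound[OF integrable_mult_right[of "\<bar>x\<bar>"]])
  show "integrable lborel (\<lambda>s::real. exp (- (s\<^sup>2) / 2) * cosh (x * s))"
    by (rule cosh_kernel_integrable)
  show "AE s in lborel. norm (exp (- (s\<^sup>2) / 2) * sinh (x * s) / s)
      \<le> norm (\<bar>x\<bar> * (exp (- (s\<^sup>2) / 2) * cosh (x * s)))"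
    using abs_sinh_kernel_le by (intro AE_I2) (simp add: abs_mult)
qed measurable

text \<open>Differentiating under the integral cancels 1/s and leaves the Gaussian cosh
  integral.\<close>

lemma sinh_kernel_int_has_derivative:
  "(sinh_kernel_int has_real_derivative sqrt (2 * pi) * exp (x\<^sup>2 / 2)) (at x)"
proof -
  define k where "k y s = exp (- (s\<^sup>2) / 2) * sinh (y * s) / s" for y s :: real
  have [measurable]: "k y \<in> borel_measurable borel" for y
    unfolding k_def by measurable
  \<comment> \<open>The factor \<open>of_bool (s \<noteq> 0)\<close> excludes the point where
    division by zero makes the quotient 0 although the cosh kernel equals 1 there.\<close>
  have "((\<lambda>y. \<integral>s. (k y s - k x s) / (y - x) * of_bool (s \<noteq> 0) \<partial>lborel) \<longlongrightarrow>
      (\<integral>s. exp (- (s\<^sup>2) / 2) * cosh (x * s) * of_bool (s \<noteq> 0) \<partial>lborel)) (at x)"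
  proof (rule integral_dominated_convergence_at)
    \<comment> \<open>For \<open>y\<close> within distance 1 of \<open>x\<close>, both parameters
      are bounded in absolute value by \<open>\<bar>x\<bar> + 1\<close>.\<close>
    show "integrable lborel (\<lambda>s. exp (- (s\<^sup>2) / 2) * cosh ((\<bar>x\<bar> + 1) * s))"
      by (rule cosh_kernel_integrable)
    have "\<forall>\<^sub>F y in at x. y \<in> {x - 1<..<x + 1} \<and> y \<noteq> x"
      by (auto simp: eventually_at_filter intro!: eventually_mono[OF eventually_nhds_in_open[of "{x - 1<..<x + 1}"]])
    then show "\<forall>\<^sub>F y in at x. \<forall>s\<in>space lborel. \<bar>(k y s - k x s) / (y - x) * of_bool (s \<noteq> 0)\<bar>
        \<le> exp (- (s\<^sup>2) / 2) * cosh ((\<bar>x\<bar> + 1) * s)"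
    proof eventually_elim
      case (elim y)
      have "\<bar>k y s - k x s\<bar> \<le> \<bar>y - x\<bar> * (exp (- (s\<^sup>2) / 2) * cosh ((\<bar>x\<bar> + 1) * s))" for s
        unfolding k_def by (rule abs_sinh_kernel_diff_le) (use elim in auto)
      then have "\<bar>(k y s - k x s) / (y - x)\<bar> \<le> exp (- (s\<^sup>2) / 2) * cosh ((\<bar>x\<bar> + 1) * s)" for s
        using elim by (simp add: abs_divide divide_le_eq mult.commute)
      then show ?case
        by (auto simp: of_bool_def)
    qed
    show "((\<lambda>y. (k y s - k x s) / (y - x) * of_bool (s \<noteq> 0)) \<longlongrightarrow>
        exp (- (s\<^sup>2) / 2) * cosh (x * s) * of_bool (s \<noteq> 0)) (at x)" for s
    proof (cases "s = 0")
      case False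
      have "((\<lambda>y. k y s) has_real_derivative exp (- (s\<^sup>2) / 2) * cosh (x * s)) (at x)"
        unfolding k_def using False by (auto intro!: derivative_eq_intros)
      then show ?thesis
        using False by (simp add: has_field_derivative_iff)
    qed simp
  qed measurable
  also have "(\<integral>s. exp (- (s\<^sup>2) / 2) * cosh (x * s) * of_bool (s \<noteq> 0) \<partial>lborel) =
      (\<integral>s. exp (- (s\<^sup>2) / 2) * cosh (x * s) \<partial>lborel)"
  proof (intro integral_cong_AE)
    show "AE s in lborel. exp (- (s\<^sup>2) / 2) * cosh (x * s) * of_bool (s \<noteq> 0) = exp (- (s\<^sup>2) / 2) * cosh (x * s)"
      using AE_lborel_singleton[of 0] by eventually_elim simp
  qed measurable
  also have "\<dots> = sqrt (2 * pi) * exp (x\<^sup>2 / 2)"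
    using gauss_cosh_integral by (rule has_bochner_integral_integral_eq)
  also have "(\<lambda>y. \<integral>s. (k y s - k x s) / (y - x) * of_bool (s \<noteq> 0) \<partial>lborel) =
      (\<lambda>y. (sinh_kernel_int y - sinh_kernel_int x) / (y - x))"
  proof
    fix y
    have "(\<lambda>s. (k y s - k x s) / (y - x) * of_bool (s \<noteq> 0)) = (\<lambda>s. (k y s - k x s) / (y - x))"
      by (auto simp: k_def)
    then show "(\<integral>s. (k y s - k x s) / (y - x) * of_bool (s \<noteq> 0) \<partial>lborel) =
        (sinh_kernel_int y - sinh_kernel_int x) / (y - x)"
      using sinh_kernel_integrable by (simp add: sinh_kernel_int_def k_def)
  qed
  finally show ?thesis
    by (simp add: has_field_derivative_iff)
qed

section \<open>Principal values\<close>

lemma has_principal_value_unique: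
  assumes "has_principal_value f x L" "has_principal_value f x L'"
  shows "L = L'"
  using assms unfolding has_principal_value_def
  by (auto intro: tendsto_unique[OF trivial_limit_at_right_real])

lemma principal_value_eqI: "has_principal_value f x L \<Longrightarrow> principal_value f x = L"
  unfolding principal_value_def by (blast intro: has_principal_value_unique)

lemma has_principal_value_add:
  assumes "has_principal_value f x L" "has_principal_value g x M"
  shows "has_principal_value (\<lambda>t. f t + g t) x (L + M)"
proof -
  have "((\<lambda>\<epsilon>. (LINT t:{t. \<bar>t - x\<bar> > \<epsilon>}|lborel. f t) + (LINT t:{t. \<bar>t - x\<bar> > \<epsilon>}|lborel. g t)) \<longlongrightarrow> L + M)
      (at_right 0)"
    using assms by (intro tendsto_add) (auto simp: has_principal_value_def)
  moreover have "\<forall>\<^sub>F \<epsilon> in at_right 0.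
      (LINT t:{t. \<bar>t - x\<bar> > \<epsilon>}|lborel. f t) + (LINT t:{t. \<bar>t - x\<bar> > \<epsilon>}|lborel. g t) =
      (LINT t:{t. \<bar>t - x\<bar> > \<epsilon>}|lborel. f t + g t)"
    using eventually_at_right_less[of 0]
    by eventually_elim (use assms in \<open>auto simp: has_principal_value_def set_integral_add\<close>)
  ultimately show ?thesis
    using assms by (auto simp: has_principal_value_def intro: set_integral_add elim: Lim_transform_eventually)
qed

lemma has_principal_value_cmult:
  assumes "has_principal_value f x L"
  shows "has_principal_value (\<lambda>t. c * f t) x (c * L)"
  using assms by (auto simp: has_principal_value_def intro: tendsto_mult_left)

text \<open>Allows algebraic identities that cancel \<open>t - x\<close> and fail at the singularity
  itself.\<close>

lemma has_principal_value_cong: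
  assumes "\<And>t. t \<noteq> x \<Longrightarrow> f t = g t"
  shows "has_principal_value f x L \<longleftrightarrow> has_principal_value g x L"
proof -
  have eq: "indicator {t. \<bar>t - x\<bar> > \<epsilon>} t *\<^sub>R f t = indicator {t. \<bar>t - x\<bar> > \<epsilon>} t *\<^sub>R g t"
    if "\<epsilon> > 0" for \<epsilon> t
    using assms that by (cases "t = x") (auto simp: indicator_def)
  have "\<forall>\<^sub>F \<epsilon> in at_right 0. (LINT t:{t. \<bar>t - x\<bar> > \<epsilon>}|lborel. f t) = (LINT t:{t. \<bar>t - x\<bar> > \<epsilon>}|lborel. g t)"
    using eventually_at_right_less[of 0]
    by eventually_elim (simp only: set_lebesgue_integral_def eq)
  note lim = tendsto_cong[OF this]
  have "set_integrable lborel {t. \<bar>t - x\<bar> > \<epsilon>} f \<longleftrightarrow> set_integrable lborel {t. \<bar>t - x\<bar> > \<epsilon>} g"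
    if "\<epsilon> > 0" for \<epsilon>
    unfolding set_integrable_def eq[OF that] ..
  with lim show ?thesis
    by (auto simp: has_principal_value_def)
qed

lemma has_principal_value_integral:
  assumes "integrable lborel f"
  shows "has_principal_value f x (\<integral>t. f t \<partial>lborel)"
  unfolding has_principal_value_def
proof (intro conjI allI impI)
  have [measurable]: "f \<in> borel_measurable borel"
    using assms by auto
  show "set_integrable lborel {t. \<epsilon> < \<bar>t - x\<bar>} f" for \<epsilon>
    using assms unfolding set_integrable_def by (intro integrable_mult_indicator) auto
  \<comment> \<open>The truncations converge pointwise to \<open>f\<close> off \<open>x\<close> and
    are 0 at \<open>x\<close>; this limit differs from \<open>f\<close> on a null set at
    most.\<close>
  have "((\<lambda>\<epsilon>. LINT t:{t. \<epsilon> < \<bar>t - x\<bar>}|lborel. f t) \<longlongrightarrow> (\<integral>t. f t * of_bool (t \<noteq> x) \<partial>lborel)) (at_right 0)"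
    unfolding set_lebesgue_integral_def
  proof (rule integral_dominated_convergence_at)
    show "integrable lborel (\<lambda>t. \<bar>f t\<bar>)"
      using assms by simp
    show "((\<lambda>\<epsilon>. indicator {t. \<epsilon> < \<bar>t - x\<bar>} t *\<^sub>R f t) \<longlongrightarrow> f t * of_bool (t \<noteq> x)) (at_right 0)" for t
    proof (rule tendsto_eventually, cases "t = x")
      case True
      show "\<forall>\<^sub>F \<epsilon> in at_right 0. indicator {t. \<epsilon> < \<bar>t - x\<bar>} t *\<^sub>R f t = f t * of_bool (t \<noteq> x)"
        using eventually_at_right_less[of 0] by eventually_elim (use True in auto)
    next
      case False
      then have "\<forall>\<^sub>F \<epsilon> in at_right 0. \<epsilon> < \<bar>t - x\<bar>"
        by (intro eventually_at_right_field[THEN iffD2] exI[of _ "\<bar>t - x\<bar>"]) auto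
      then show "\<forall>\<^sub>F \<epsilon> in at_right 0. indicator {t. \<epsilon> < \<bar>t - x\<bar>} t *\<^sub>R f t = f t * of_bool (t \<noteq> x)"
        by eventually_elim (use False in auto)
    qed
    show "\<forall>\<^sub>F \<epsilon> in at_right 0. \<forall>t\<in>space lborel. \<bar>indicator {t. \<epsilon> < \<bar>t - x\<bar>} t *\<^sub>R f t\<bar> \<le> \<bar>f t\<bar>"
      by (intro always_eventually) (auto simp: indicator_def)
  qed measurable
  also have "(\<integral>t. f t * of_bool (t \<noteq> x) \<partial>lborel) = (\<integral>t. f t \<partial>lborel)"
  proof (rule integral_cong_AE)
    show "AE t in lborel. f t * of_bool (t \<noteq> x) = f t"
      using AE_lborel_singleton[of x] by eventually_elim simp
  qed measurable
  finally show "((\<lambda>\<epsilon>. LINT t:{t. \<epsilon> < \<bar>t - x\<bar>}|lborel. f t) \<longlongrightarrow> (\<integral>t. f t \<partial>lborel)) (at_right 0)" .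
qed

text \<open>Reflection in \<open>x\<close> preserves the truncated domain. Averaging the
  substitutions t = x + s and t = x - s cancels the singularity in the integrand. The form
  \<open>\<bar>s - 0\<bar>\<close> matches a principal value at 0.\<close>

lemma truncated_gaussian_cauchy_integral:
  fixes x \<epsilon> :: real
  assumes "\<epsilon> > 0"
  shows "set_integrable lborel {t. \<bar>t - x\<bar> > \<epsilon>} (\<lambda>t. exp (- (t\<^sup>2) / 2) / (t - x))" (is ?int)
    and "(LINT t:{t. \<bar>t - x\<bar> > \<epsilon>}|lborel. exp (- (t\<^sup>2) / 2) / (t - x)) =
      (LINT s:{s. \<bar>s - 0\<bar> > \<epsilon>}|lborel. - exp (- (x\<^sup>2) / 2) * (exp (- (s\<^sup>2) / 2) * sinh (x * s) / s))" (is ?eq)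
proof -
  define f where "f t = indicator {t. \<bar>t - x\<bar> > \<epsilon>} t *\<^sub>R (exp (- (t\<^sup>2) / 2) / (t - x))" for t
  have f: "integrable lborel f"
  proof (rule Bochner_Integration.integrable_bound)
    \<comment> \<open>On the truncated domain 1 / \<open>\<bar>t - x\<bar>\<close> is less than 1 /
      \<open>\<epsilon>\<close>.\<close>
    show "integrable lborel (\<lambda>t. 1 / \<epsilon> * (exp (- (1 / 2 * t\<^sup>2)) * poly 1 t))"
      by (intro integrable_mult_right gauss_poly_integrable) simp
    show "f \<in> borel_measurable lborel"
      unfolding f_def by measurable
    have "\<bar>f t\<bar> \<le> exp (- (t\<^sup>2) / 2) / \<epsilon>" for t
      using assms by (auto simp: f_def indicator_def intro!: divide_left_mono mult_pos_pos)
    then show "AE t in lborel. norm (f t) \<le> norm (1 / \<epsilon> * (exp (- (1 / 2 * t\<^sup>2)) * poly 1 t))"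
      using assms by (intro AE_I2) simp
  qed
  then show ?int
    by (simp only: set_integrable_def f_def[abs_def])
  have "2 * (\<integral>t. f t \<partial>lborel) = (\<integral>s. f (x + 1 * s) \<partial>lborel) + (\<integral>s. f (x + (-1) * s) \<partial>lborel)"
    using lborel_integral_real_affine[of 1 f x] lborel_integral_real_affine[of "-1" f x] by simp
  also have "\<dots> = (\<integral>s. f (x + 1 * s) + f (x + (-1) * s) \<partial>lborel)"
    by (intro Bochner_Integration.integral_add [symmetric] lborel_integrable_real_affine f) simp_all
  also have "\<dots> = (\<integral>s. 2 * (indicator {s. \<bar>s - 0\<bar> > \<epsilon>} s *\<^sub>R
      (- exp (- (x\<^sup>2) / 2) * (exp (- (s\<^sup>2) / 2) * sinh (x * s) / s))) \<partial>lborel)"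
  proof (intro Bochner_Integration.integral_cong refl)
    fix s :: real
    have "exp (- ((x + s)\<^sup>2) / 2) = exp (- (x\<^sup>2) / 2) * exp (- (s\<^sup>2) / 2) * exp (- (x * s))"
      "exp (- ((x - s)\<^sup>2) / 2) = exp (- (x\<^sup>2) / 2) * exp (- (s\<^sup>2) / 2) * exp (x * s)"
      by (simp_all add: power2_eq_square field_simps flip: exp_add)
    then have "exp (- ((x + s)\<^sup>2) / 2) / s - exp (- ((x - s)\<^sup>2) / 2) / s =
        2 * (- exp (- (x\<^sup>2) / 2) * (exp (- (s\<^sup>2) / 2) * sinh (x * s) / s))"
      by (cases "s = 0") (simp_all add: sinh_def field_simps)
    then show "f (x + 1 * s) + f (x + (-1) * s) = 2 * (indicator {s. \<bar>s - 0\<bar> > \<epsilon>} s *\<^sub>R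
      (- exp (- (x\<^sup>2) / 2) * (exp (- (s\<^sup>2) / 2) * sinh (x * s) / s)))"
      by (simp add: f_def indicator_def)
  qed
  also have "\<dots> = 2 * (LINT s:{s. \<bar>s - 0\<bar> > \<epsilon>}|lborel. - exp (- (x\<^sup>2) / 2) * (exp (- (s\<^sup>2) / 2) * sinh (x * s) / s))"
    unfolding set_lebesgue_integral_def by (rule integral_mult_right_zero)
  finally show ?eq
    by (simp only: f_def set_lebesgue_integral_def mult_cancel_left) simp
qed

text \<open>After symmetrisation the truncations are those of an absolutely integrable function,
  whose principal value is its ordinary integral.\<close>

lemma has_principal_value_gaussian:
  "has_principal_value (\<lambda>t. exp (- (t\<^sup>2) / 2) / (t - x)) x (- exp (- (x\<^sup>2) / 2) * sinh_kernel_int x)"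
proof -
  have "has_principal_value (\<lambda>s. - exp (- (x\<^sup>2) / 2) * (exp (- (s\<^sup>2) / 2) * sinh (x * s) / s)) 0
      (- exp (- (x\<^sup>2) / 2) * sinh_kernel_int x)"
    unfolding sinh_kernel_int_def
    by (intro has_principal_value_cmult has_principal_value_integral sinh_kernel_integrable)
  then have "((\<lambda>\<epsilon>. LINT s:{s. \<bar>s - 0\<bar> > \<epsilon>}|lborel. - exp (- (x\<^sup>2) / 2) * (exp (- (s\<^sup>2) / 2) * sinh (x * s) / s))
      \<longlongrightarrow> - exp (- (x\<^sup>2) / 2) * sinh_kernel_int x) (at_right 0)"
    unfolding has_principal_value_def by blast
  moreover have "\<forall>\<^sub>F \<epsilon> in at_right 0.
      (LINT s:{s. \<bar>s - 0\<bar> > \<epsilon>}|lborel. - exp (- (x\<^sup>2) / 2) * (exp (- (s\<^sup>2) / 2) * sinh (x * s) / s)) =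
      (LINT t:{t. \<bar>t - x\<bar> > \<epsilon>}|lborel. exp (- (t\<^sup>2) / 2) / (t - x))"
    using eventually_at_right_less[of 0]
    by eventually_elim (simp only: truncated_gaussian_cauchy_integral)
  ultimately show ?thesis
    unfolding has_principal_value_def
    using truncated_gaussian_cauchy_integral(1) by (blast intro: Lim_transform_eventually)
qed

section \<open>The Cauchy transform of a polynomial times the Gaussian\<close>

definition gauss_cauchy :: "real poly \<Rightarrow> real \<Rightarrow> real" where
  "gauss_cauchy p x = principal_value (\<lambda>t. exp (- (t\<^sup>2) / 2) * poly p t / (t - x)) x"

text \<open>Splits a + t q(t) over t - x by writing t = x + (t - x); the last part has no
  singularity and contributes a plain moment.\<close>

lemma has_principal_value_pCons:
  assumes "has_principal_value (\<lambda>t. exp (- (t\<^sup>2) / 2) / (t - x)) x K"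
    and "has_principal_value (\<lambda>t. exp (- (t\<^sup>2) / 2) * poly q t / (t - x)) x L"
  shows "has_principal_value (\<lambda>t. exp (- (t\<^sup>2) / 2) * poly (pCons a q) t / (t - x)) x
    (a * K + x * L + gauss_int (1 / 2) q)"
proof -
  have q: "gauss_int (1 / 2) q = (\<integral>t. exp (- (t\<^sup>2) / 2) * poly q t \<partial>lborel)"
    "integrable lborel (\<lambda>t. exp (- (t\<^sup>2) / 2) * poly q t)"
    using gauss_poly_integrable[of "1 / 2" q] by (simp_all add: gauss_int_def)
  have "a * (w / d) + x * (w * r / d) + w * r = w * (a + (x + d) * r) / d" if "d \<noteq> 0" for w d r
    using that by (simp add: field_simps)
  from this[of "t - x" for t]
  have eq: "a * (exp (- (t\<^sup>2) / 2) / (t - x)) + x * (exp (- (t\<^sup>2) / 2) * poly q t / (t - x)) +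
      exp (- (t\<^sup>2) / 2) * poly q t = exp (- (t\<^sup>2) / 2) * poly (pCons a q) t / (t - x)" if "t \<noteq> x" for t
    using that by simp
  have "has_principal_value (\<lambda>t. a * (exp (- (t\<^sup>2) / 2) / (t - x)) +
      x * (exp (- (t\<^sup>2) / 2) * poly q t / (t - x)) + exp (- (t\<^sup>2) / 2) * poly q t) x
      (a * K + x * L + gauss_int (1 / 2) q)"
    unfolding q(1)
    by (intro has_principal_value_add has_principal_value_cmult has_principal_value_integral assms q(2))
  then show ?thesis
    by (rule has_principal_value_cong[THEN iffD1, rotated]) (rule eq)
qed

text \<open>Induction on the coefficients gives existence, so the definite description in
  \<open>principal_value\<close> denotes the actual limit.\<close>

lemma has_principal_value_gauss_cauchy:
  "has_principal_value (\<lambda>t. exp (- (t\<^sup>2) / 2) * poly p t / (t - x)) x (gauss_cauchy p x)"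
proof -
  have "\<exists>L. has_principal_value (\<lambda>t. exp (- (t\<^sup>2) / 2) * poly p t / (t - x)) x L"
  proof (induction p)
    case 0
    show ?case
      using has_principal_value_cmult[OF has_principal_value_gaussian, of 0 x] by auto
  next
    case (pCons a q)
    then show ?case
      using has_principal_value_pCons[OF has_principal_value_gaussian] by blast
  qed
  then obtain L where L: "has_principal_value (\<lambda>t. exp (- (t\<^sup>2) / 2) * poly p t / (t - x)) x L" ..
  then show ?thesis
    unfolding gauss_cauchy_def principal_value_eqI[OF L] .
qed

lemma gauss_cauchy_1: "gauss_cauchy 1 x = - exp (- (x\<^sup>2) / 2) * sinh_kernel_int x"
  unfolding gauss_cauchy_def
  by (rule principal_value_eqI) (use has_principal_value_gaussian in simp)

lemma gauss_cauchy_pCons: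
  "gauss_cauchy (pCons a q) x = a * gauss_cauchy 1 x + x * gauss_cauchy q x + gauss_int (1 / 2) q"
  unfolding gauss_cauchy_def[of "pCons a q"] gauss_cauchy_1
  by (intro principal_value_eqI has_principal_value_pCons has_principal_value_gaussian
      has_principal_value_gauss_cauchy)

lemma gauss_cauchy_0 [simp]: "gauss_cauchy 0 x = 0"
  using has_principal_value_cmult[OF has_principal_value_gaussian, of 0 x]
  by (simp add: gauss_cauchy_def principal_value_eqI)

lemma gauss_cauchy_add: "gauss_cauchy (p + q) x = gauss_cauchy p x + gauss_cauchy q x"
  unfolding gauss_cauchy_def[of "p + q"]
  by (rule principal_value_eqI)
    (use has_principal_value_add[OF has_principal_value_gauss_cauchy[of p x] has_principal_value_gauss_cauchy[of q x]]
      in \<open>simp add: distrib_left add_divide_distrib\<close>)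

lemma gauss_cauchy_smult: "gauss_cauchy (smult c p) x = c * gauss_cauchy p x"
  unfolding gauss_cauchy_def[of "smult c p"]
  by (rule principal_value_eqI)
    (use has_principal_value_cmult[OF has_principal_value_gauss_cauchy[of p x], of c] in \<open>simp add: mult_ac\<close>)

lemma gauss_cauchy_diff: "gauss_cauchy (p - q) x = gauss_cauchy p x - gauss_cauchy q x"
  using gauss_cauchy_add[of "p - q" q x] by simp

lemma gauss_int_half_1: "gauss_int (1 / 2) 1 = sqrt (2 * pi)"
  using gauss_int_even_power[of "1 / 2" 0] by (simp add: mult.commute)

lemma gauss_int_half_pderiv: "gauss_int (1 / 2) (pderiv p) = gauss_int (1 / 2) (pCons 0 p)"
  using gauss_int_pderiv[of "1 / 2" p] by simp

text \<open>In the product rule the factor exp(x^2/2) from the derivative of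
  \<open>sinh_kernel_int\<close> cancels the prefactor and leaves a constant.\<close>

lemma gauss_cauchy_1_has_derivative:
  "(gauss_cauchy 1 has_real_derivative - x * gauss_cauchy 1 x - sqrt (2 * pi)) (at x)"
proof -
  have "((\<lambda>x. - exp (- (x\<^sup>2) / 2) * sinh_kernel_int x) has_real_derivative
      - x * (- exp (- (x\<^sup>2) / 2) * sinh_kernel_int x) - exp (- (x\<^sup>2) / 2) * exp (x\<^sup>2 / 2) * sqrt (2 * pi)) (at x)"
    by (auto intro!: derivative_eq_intros sinh_kernel_int_has_derivative simp: field_simps)
  moreover have "gauss_cauchy 1 = (\<lambda>x. - exp (- (x\<^sup>2) / 2) * sinh_kernel_int x)"
    by (intro ext gauss_cauchy_1)
  ultimately show ?thesis
    by (simp flip: exp_add)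
qed

text \<open>Differentiating the transform amounts to differentiating the density: the derivative of
  exp(-t^2/2) p(t) is exp(-t^2/2) (p'(t) - t p(t)).\<close>

lemma gauss_cauchy_has_derivative:
  "(gauss_cauchy p has_real_derivative gauss_cauchy (pderiv p - pCons 0 p) x) (at x)"
proof (induction p)
  case (pCons a q)
  have "gauss_int (1 / 2) (pCons a q) = gauss_int (1 / 2) (smult a 1 + pCons 0 q)"
    by simp
  \<comment> \<open>Of the new moments, M(q') and M(X q) cancel by integration by parts; the
    remaining a sqrt(2 pi) matches the constant in the derivative of the transform of 1.\<close>
  then have M: "gauss_int (1 / 2) (pCons a q) = a * sqrt (2 * pi) + gauss_int (1 / 2) (pCons 0 q)"
    by (simp only: gauss_int_add[of "1/2", simplified] gauss_int_smult gauss_int_half_1)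
  have "gauss_cauchy (pCons a q) = (\<lambda>x. a * gauss_cauchy 1 x + x * gauss_cauchy q x + gauss_int (1 / 2) q)"
    by (simp add: fun_eq_iff gauss_cauchy_pCons)
  moreover have "((\<lambda>x. a * gauss_cauchy 1 x + x * gauss_cauchy q x + gauss_int (1 / 2) q) has_real_derivative
      a * (- x * gauss_cauchy 1 x - sqrt (2 * pi)) +
      (gauss_cauchy q x + x * gauss_cauchy (pderiv q - pCons 0 q) x)) (at x)"
    by (auto intro!: derivative_eq_intros pCons.IH gauss_cauchy_1_has_derivative simp: algebra_simps)
  moreover have "gauss_cauchy (pderiv (pCons a q) - pCons 0 (pCons a q)) x =
      a * (- x * gauss_cauchy 1 x - sqrt (2 * pi)) +
      (gauss_cauchy q x + x * gauss_cauchy (pderiv q - pCons 0 q) x)"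
    by (simp only: pderiv_pCons gauss_cauchy_diff gauss_cauchy_add gauss_cauchy_pCons M gauss_int_half_pderiv)
      (simp add: algebra_simps)
  ultimately show ?case
    by simp
qed simp

text \<open>The map from p to p' - X p, applied twice.\<close>

lemma gauss_cauchy_has_second_derivative:
  "(deriv (gauss_cauchy p) has_real_derivative
    gauss_cauchy (pderiv (pderiv p) - smult 2 (pCons 0 (pderiv p)) - p + pCons 0 (pCons 0 p)) x) (at x)"
proof -
  have "deriv (gauss_cauchy p) = gauss_cauchy (pderiv p - pCons 0 p)"
    by (intro ext DERIV_imp_deriv gauss_cauchy_has_derivative)
  moreover have "pderiv (pderiv p - pCons 0 p) - pCons 0 (pderiv p - pCons 0 p) =
      pderiv (pderiv p) - smult 2 (pCons 0 (pderiv p)) - p + pCons 0 (pCons 0 p)"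
    by (rule poly_eqI) (simp add: pderiv_diff pderiv_pCons coeff_pCons split: nat.split)
  ultimately show ?thesis
    using gauss_cauchy_has_derivative[of "pderiv p - pCons 0 p" x] by simp
qed

section \<open>Hermite's equation, and moments of Hermite polynomials for the weight
  exp(-t^2/2)\<close>

text \<open>For n = k + 1 the left side is 2n (H_k' - 2 X H_k), and the recurrence identifies the
  bracket with -H_n.\<close>

lemma physicist_hermite_ode:
  "pderiv (pderiv (physicist_hermite n)) - smult 2 (pCons 0 (pderiv (physicist_hermite n))) =
    smult (- (2 * real n)) (physicist_hermite n)"
proof (cases n)
  case (Suc k)
  show ?thesis
    unfolding Suc pderiv_physicist_hermite_Suc pderiv_smult unfolding physicist_hermite.simps
    by (rule poly_eqI) (simp add: coeff_pCons algebra_simps split: nat.split)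
qed simp

text \<open>By the recurrence the left side is 2 M(X H_n) - M(H_n'), and M(X H_n) = M(H_n') for this
  weight.\<close>

lemma gauss_int_half_hermite_Suc:
  "gauss_int (1 / 2) (physicist_hermite (Suc n)) = gauss_int (1 / 2) (pderiv (physicist_hermite n))"
  using gauss_int_half_pderiv[of "physicist_hermite n"]
  by (simp add: gauss_int_diff gauss_int_smult del: smult_pCons)

lemma gauss_int_half_hermite_Suc_Suc:
  "gauss_int (1 / 2) (physicist_hermite (Suc (Suc n))) =
    2 * real (Suc n) * gauss_int (1 / 2) (physicist_hermite n)"
  unfolding gauss_int_half_hermite_Suc[of "Suc n"] pderiv_physicist_hermite_Suc gauss_int_smult ..

lemma gauss_int_half_hermite_even:
  "gauss_int (1 / 2) (physicist_hermite (2 * m)) = sqrt (2 * pi) * (fact (2 * m) / fact m)"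
proof (induction m)
  case (Suc m)
  have "gauss_int (1 / 2) (physicist_hermite (2 * Suc m)) =
      2 * real (Suc (2 * m)) * gauss_int (1 / 2) (physicist_hermite (2 * m))"
    using gauss_int_half_hermite_Suc_Suc[of "2 * m"] by (simp del: physicist_hermite.simps)
  also have "\<dots> = sqrt (2 * pi) * (fact (2 * Suc m) / fact (Suc m))"
    unfolding Suc.IH by (simp add: divide_simps) (simp add: algebra_simps)
  finally show ?case .
qed (simp add: gauss_int_half_1)

lemma gauss_int_half_hermite_odd: "gauss_int (1 / 2) (physicist_hermite (2 * m + 1)) = 0"
proof (induction m)
  case (Suc m)
  then show ?case
    using gauss_int_half_hermite_Suc_Suc[of "2 * m + 1"] by simp
qed (use gauss_int_half_hermite_Suc[of 0] in simp)

text \<open>The two claims alternate in one induction. At 0 the transform of X p is just the moment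
  of p, and the odd Hermite moments vanish.\<close>

lemma gauss_cauchy_hermite_at_0:
  "gauss_cauchy (physicist_hermite (2 * m)) 0 = 0 \<and>
   (gauss_cauchy (physicist_hermite (2 * m + 1)) has_real_derivative 0) (at 0)"
proof -
  let ?T = "\<lambda>n. gauss_cauchy (physicist_hermite n)"
  have odd: "(?T (2 * m + 1) has_real_derivative 0) (at 0)" if "?T (2 * m) 0 = 0" for m
  proof -
    have "gauss_cauchy (pderiv (physicist_hermite (2 * m + 1)) - pCons 0 (physicist_hermite (2 * m + 1))) 0 = 0"
      using that gauss_int_half_hermite_odd[of m] pderiv_physicist_hermite_Suc[of "2 * m"]
      by (simp add: gauss_cauchy_diff gauss_cauchy_smult gauss_cauchy_pCons del: physicist_hermite.simps)
    then show ?thesis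
      using gauss_cauchy_has_derivative[of "physicist_hermite (2 * m + 1)" 0] by simp
  qed
  moreover have "?T (2 * m) 0 = 0"
  proof (induction m)
    case 0
    show ?case
      \<comment> \<open>For \<open>x = 0\<close> the sinh kernel is identically 0.\<close>
      by (simp add: gauss_cauchy_1 sinh_kernel_int_def)
  next
    case (Suc m)
    let ?p = "physicist_hermite (2 * m + 1)"
    \<comment> \<open>The vanishing derivative is read back as a value of the transform; with the
      zero odd moment it yields the value for the next even index.\<close>
    have "gauss_cauchy (pderiv ?p - pCons 0 ?p) 0 = 0"
      using DERIV_unique[OF gauss_cauchy_has_derivative odd[OF Suc.IH]] .
    moreover have "physicist_hermite (2 * Suc m) = smult 2 (pCons 0 ?p) - pderiv ?p"
      by (simp del: physicist_hermite.simps add: physicist_hermite.simps(2)[of "Suc (2 * m)"])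
    ultimately show ?case
      using gauss_int_half_hermite_odd[of m]
      by (simp add: gauss_cauchy_diff gauss_cauchy_smult gauss_cauchy_pCons gauss_int_smult del: physicist_hermite.simps)
  qed
  ultimately show ?thesis
    by blast
qed

section \<open>The differential equations for \<open>G\<close>\<close>

lemma G_eq_gauss_cauchy: "G n = (\<lambda>x. 1 / pi * gauss_cauchy (physicist_hermite n) x)"
  by (simp add: fun_eq_iff G_def G_integrand_def[abs_def] gauss_cauchy_def hermite_eq_physicist_hermite)

text \<open>Both parities at once: 2n + 1 is 4m + 1 or 4m + 3, and parity later removes one of the
  two moments on the right.\<close>

lemma G_ode:
  "G n differentiable at x"
  "deriv (G n) differentiable at x"
  "deriv (deriv (G n)) x + (2 * real n + 1 - x\<^sup>2) * G n x =
    1 / pi * (x * gauss_int (1 / 2) (physicist_hermite n) + gauss_int (1 / 2) (pderiv (physicist_hermite n)))"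
proof -
  let ?h = "physicist_hermite n"
  have deriv_h: "deriv (gauss_cauchy ?h) = gauss_cauchy (pderiv ?h - pCons 0 ?h)"
    by (intro ext DERIV_imp_deriv gauss_cauchy_has_derivative)
  have d1: "(G n has_real_derivative 1 / pi * deriv (gauss_cauchy ?h) x) (at x)" for x
    unfolding G_eq_gauss_cauchy deriv_h by (rule DERIV_cmult[OF gauss_cauchy_has_derivative])
  then have "deriv (G n) = (\<lambda>x. 1 / pi * deriv (gauss_cauchy ?h) x)"
    by (intro ext DERIV_imp_deriv)
  then have d2: "(deriv (G n) has_real_derivative 1 / pi *
      gauss_cauchy (pderiv (pderiv ?h) - smult 2 (pCons 0 (pderiv ?h)) - ?h + pCons 0 (pCons 0 ?h)) x) (at x)"
    by (simp only: DERIV_cmult[OF gauss_cauchy_has_second_derivative])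
  show "G n differentiable at x" "deriv (G n) differentiable at x"
    using d1 d2 by (auto simp: real_differentiable_def)
  have "gauss_cauchy (pderiv (pderiv ?h) - smult 2 (pCons 0 (pderiv ?h)) - ?h + pCons 0 (pCons 0 ?h)) x =
      (x\<^sup>2 - (2 * real n + 1)) * gauss_cauchy ?h x + x * gauss_int (1 / 2) ?h + gauss_int (1 / 2) (pderiv ?h)"
    unfolding physicist_hermite_ode
    by (simp only: gauss_cauchy_add gauss_cauchy_diff gauss_cauchy_smult gauss_cauchy_pCons gauss_int_half_pderiv)
      (simp add: algebra_simps power2_eq_square)
  then show "deriv (deriv (G n)) x + (2 * real n + 1 - x\<^sup>2) * G n x =
    1 / pi * (x * gauss_int (1 / 2) ?h + gauss_int (1 / 2) (pderiv ?h))"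
    using DERIV_imp_deriv[OF d2] by (simp add: G_eq_gauss_cauchy field_simps)
qed

theorem mainTheorem6:
  shows "(\<forall>n x. \<exists>L. has_principal_value (G_integrand n x) x L) \<and>
    (\<forall>m::nat.
      (\<forall>x::real. 0 < x \<longrightarrow>
         G (2 * m) differentiable at x \<and>
         deriv (G (2 * m)) differentiable at x \<and>
         deriv (deriv (G (2 * m))) x + (4 * real m + 1 - x ^ 2) * G (2 * m) x
           = sqrt (2 / pi) * (fact (2 * m) / fact m) * x) \<and>
      G (2 * m) 0 = 0 \<and>
      (\<forall>x::real. 0 < x \<longrightarrow>
         G (2 * m + 1) differentiable at x \<and>
         deriv (G (2 * m + 1)) differentiable at x \<and>
         deriv (deriv (G (2 * m + 1))) x + (4 * real m + 3 - x ^ 2) * G (2 * m + 1) x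
           = sqrt (2 / pi) * (2 * fact (2 * m + 1) / fact m)) \<and>
      (G (2 * m + 1) has_real_derivative 0) (at 0))"
proof (intro conjI allI impI)
  show "\<exists>L. has_principal_value (G_integrand n x) x L" for n x
    using has_principal_value_gauss_cauchy[of "hermite n" x] unfolding G_integrand_def[abs_def] by blast
next
  fix m :: nat and x :: real
  have sqrt_eq: "sqrt (2 * pi) / pi = sqrt (2 / pi)"
    by (simp add: real_sqrt_mult real_sqrt_divide field_simps)
  show "G (2 * m) differentiable at x" "deriv (G (2 * m)) differentiable at x"
    "G (2 * m + 1) differentiable at x" "deriv (G (2 * m + 1)) differentiable at x"
    by (rule G_ode)+
  \<comment> \<open>This moment equals that of the odd polynomial H_(2m+1).\<close>
  have "gauss_int (1 / 2) (pderiv (physicist_hermite (2 * m))) = 0"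
    using gauss_int_half_hermite_odd[of m] gauss_int_half_hermite_Suc[of "2 * m"] by simp
  then show "deriv (deriv (G (2 * m))) x + (4 * real m + 1 - x ^ 2) * G (2 * m) x
      = sqrt (2 / pi) * (fact (2 * m) / fact m) * x"
    using G_ode(3)[of "2 * m" x] unfolding gauss_int_half_hermite_even sqrt_eq [symmetric]
    by simp
  \<comment> \<open>The derivative is 2(2m+1) H_(2m), and the factor 2m+1 turns (2m)! into
    (2m+1)!.\<close>
  have "gauss_int (1 / 2) (pderiv (physicist_hermite (2 * m + 1))) =
      sqrt (2 * pi) * (2 * fact (2 * m + 1) / fact m)"
    using pderiv_physicist_hermite_Suc[of "2 * m"] gauss_int_half_hermite_even[of m]
    by (simp add: gauss_int_smult del: physicist_hermite.simps)
  then show "deriv (deriv (G (2 * m + 1))) x + (4 * real m + 3 - x ^ 2) * G (2 * m + 1) x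
      = sqrt (2 / pi) * (2 * fact (2 * m + 1) / fact m)"
    using G_ode(3)[of "2 * m + 1" x] unfolding gauss_int_half_hermite_odd sqrt_eq [symmetric]
    by (simp add: add.commute del: physicist_hermite.simps)
next
  fix m
  show "G (2 * m) 0 = 0"
    using gauss_cauchy_hermite_at_0[of m] by (simp add: G_eq_gauss_cauchy)
  show "(G (2 * m + 1) has_real_derivative 0) (at 0)"
    using DERIV_cmult[of "gauss_cauchy (physicist_hermite (2 * m + 1))" 0 0 UNIV "1 / pi"]
      gauss_cauchy_hermite_at_0[of m] by (simp only: G_eq_gauss_cauchy) simp
qed

end
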